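(* Let $(\mathcal{X},p(y_1,y_2|x),\mathcal{Y}_1\times\mathcal{Y}_2)$ be any discrete memoryless broadcast channel with cooperating receivers having noiseless conference links of finite capacities $C_{12}\ge0$ (from receiver 1 to receiver 2) and $C_{21}\ge0$ (from receiver 2 to receiver 1). Then, for sending a single common message to both receivers, any achievable rate $R$ must satisfy $$R\le\sup_{p(x)}\Big\{\min\big(I(X;Y_1)+C_{21},\; I(X;Y_2)+C_{12},\; I(X;Y_1,Y_2)\big)\Big\},$$ where the supremum is over input distributions $p(x)$ on $\mathcal{X}$ and the mutual informations are computed under $p(x)p(y_1,y_2|x)$.
   Context: All alphabets are finite, $\|\mathcal{A}\|$ denotes the cardinality of a finite set $\mathcal{A}$, and mutual informations are in bits. A discrete memoryless broadcast channel with input alphabet $\mathcal{X}$, output alphabets $\mathcal{Y}_1,\mathcal{Y}_2$ and transition function $p(y_1,y_2|x)$ satisfies $p(y_1^n,y_2^n|x^n)=\prod_{i=1}^n p(y_{1,i},y_{2,i}|x_i)$; receiver $k$ observes $Y_k^n$. Conference: after reception each receiver sends at most one message to the other. There are message sets $\mathcal{W}_{12},\mathcal{W}_{21}$ with $\|\mathcal{W}_{12}\|\le 2^{nC_{12}}$, $\|\mathcal{W}_{21}\|\le 2^{nC_{21}}$. The message $W_{12}\in\mathcal{W}_{12}$ sent by receiver 1 is a function of $Y_1^n$ and of any message already received from receiver 2, and $W_{21}\in\mathcal{W}_{21}$ sent by receiver 2 is a function of $Y_2^n$ and of any message already received from receiver 1; i.e. either $W_{12}=h_{12}(Y_1^n)$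 and $W_{21}=h_{21}(Y_2^n,W_{12})$, or $W_{21}=h_{21}(Y_2^n)$ and $W_{12}=h_{12}(Y_1^n,W_{21})$. A code of block length $n$ and rate $R$ for a common message consists of a message set $\mathcal{W}=\{1,\dots,\lfloor2^{nR}\rfloor\}$, an encoder $f:\mathcal{W}\to\mathcal{X}^n$, a conference (that is, sets $\mathcal{W}_{12},\mathcal{W}_{21}$ with $\|\mathcal{W}_{12}\|\le 2^{nC_{12}}$, $\|\mathcal{W}_{21}\|\le 2^{nC_{21}}$ and maps $h_{12},h_{21}$ of one of the two forms $W_{12}=h_{12}(Y_1^n)$, $W_{21}=h_{21}(Y_2^n,W_{12})$ or $W_{21}=h_{21}(Y_2^n)$, $W_{12}=h_{12}(Y_1^n,W_{21})$), and decoders $g_1:\mathcal{W}_{21}\times\mathcal{Y}_1^n\to\mathcal{W}$, $g_2:\mathcal{W}_{12}\times\mathcal{Y}_2^n\to\mathcal{W}$. The message $W$ is uniform on $\mathcal{W}$ and $P_e^{(n)}=\Pr(g_1(W_{21},Y_1^n)\ne W\text{ or }g_2(W_{12},Y_2^n)\ne W)$. A rate $R\ge0$ is achievable if for every $\delta>0$ there is a sequence of codes ($n\to\infty$) of rate $\max(R-\delta,0)$ with $P_e^{(n)}\to0$. *)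

theory Defs
  imports "HOL-Probability.Probability"
begin

text \<open>A length-n sequence over a finite alphabet (a finite type) is an extensional function on
  \<open>{..<n}\<close>.\<close>

definition seqs :: "nat \<Rightarrow> (nat \<Rightarrow> 'a) set" where
  "seqs n = {..<n} \<rightarrow>\<^sub>E UNIV"

text \<open>A broadcast channel is a kernel \<open>'x \<Rightarrow> ('y1 \<times> 'y2) pmf\<close>.  The lemma \<open>pmf_dmbc\<close> below
  is the product formula for its memoryless n-fold use.\<close>

definition dmbc ::
  "('x \<Rightarrow> ('y1 \<times> 'y2) pmf) \<Rightarrow> nat \<Rightarrow> (nat \<Rightarrow> 'x) \<Rightarrow> ((nat \<Rightarrow> 'y1) \<times> (nat \<Rightarrow> 'y2)) pmf" where
  "dmbc ch n x =
     map_pmf (\<lambda>y. (\<lambda>i\<in>{..<n}. fst (y i), \<lambda>i\<in>{..<n}. snd (y i)))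
       (Pi_pmf {..<n} undefined (\<lambda>i. ch (x i)))"

lemma pmf_dmbc:
  fixes ch :: "'x \<Rightarrow> ('y1 \<times> 'y2) pmf"
  assumes "y1 \<in> seqs n" "y2 \<in> seqs n"
  shows "pmf (dmbc ch n x) (y1, y2) = (\<Prod>i<n. pmf (ch (x i)) (y1 i, y2 i))"
proof -
  define F where "F = (\<lambda>y :: nat \<Rightarrow> 'y1 \<times> 'y2.
    (\<lambda>i\<in>{..<n}. fst (y i), \<lambda>i\<in>{..<n}. snd (y i)))"
  define D where "D = {y :: nat \<Rightarrow> 'y1 \<times> 'y2. \<forall>i. i \<notin> {..<n} \<longrightarrow> y i = undefined}"
  define z where "z = (\<lambda>i. if i < n then (y1 i, y2 i) else undefined)"
  let ?P = "Pi_pmf {..<n} undefined (\<lambda>i. ch (x i))"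
  have Fz: "F z = (y1, y2)"
    using assms by (auto simp: F_def z_def seqs_def fun_eq_iff PiE_def extensional_def)
  have uniq: "y = z" if "y \<in> D" "F y = (y1, y2)" for y
  proof
    fix i
    show "y i = z i"
    proof (cases "i < n")
      case True
      have "fst (F y) i = y1 i" "snd (F y) i = y2 i" using that by simp_all
      then show ?thesis using True by (simp add: F_def z_def prod_eq_iff)
    next
      case False
      then show ?thesis using that by (simp add: D_def z_def)
    qed
  qed
  have "pmf (dmbc ch n x) (y1, y2) = measure ?P (F -` {(y1, y2)})"
    by (simp add: dmbc_def F_def pmf_map)
  also have "\<dots> = measure ?P {z}"
  proof (rule measure_pmf.finite_measure_eq_AE)
    show "AE y in measure_pmf ?P. (y \<in> F -` {(y1, y2)}) = (y \<in> {z})"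
      using set_Pi_pmf_subset[of "{..<n}" undefined "\<lambda>i. ch (x i)"] uniq Fz
      by (auto simp: AE_measure_pmf_iff D_def)
  qed auto
  also have "\<dots> = (\<Prod>i<n. pmf (ch (x i)) (y1 i, y2 i))"
    by (simp add: measure_pmf_single pmf_Pi z_def)
  finally show ?thesis .
qed

text \<open>The two admissible orders of the conference.  Conference messages are natural numbers,
  which loses nothing since the message sets are finite.\<close>

datatype ('y1, 'y2) conference =
    Receiver1_First "(nat \<Rightarrow> 'y1) \<Rightarrow> nat" "(nat \<Rightarrow> 'y2) \<times> nat \<Rightarrow> nat"
  | Receiver2_First "(nat \<Rightarrow> 'y2) \<Rightarrow> nat" "(nat \<Rightarrow> 'y1) \<times> nat \<Rightarrow> nat"

text \<open>The pair \<open>(W12, W21)\<close> of exchanged messages.\<close>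

fun conference_messages ::
  "('y1, 'y2) conference \<Rightarrow> (nat \<Rightarrow> 'y1) \<Rightarrow> (nat \<Rightarrow> 'y2) \<Rightarrow> nat \<times> nat" where
  "conference_messages (Receiver1_First h12 h21) y1 y2 = (h12 y1, h21 (y2, h12 y1))"
| "conference_messages (Receiver2_First h21 h12) y1 y2 = (h12 (y1, h21 y2), h21 y2)"

fun valid_conference ::
  "nat \<Rightarrow> nat set \<Rightarrow> nat set \<Rightarrow> ('y1, 'y2) conference \<Rightarrow> bool" where
  "valid_conference n W12 W21 (Receiver1_First h12 h21) \<longleftrightarrow>
     h12 \<in> seqs n \<rightarrow> W12 \<and> h21 \<in> (seqs n \<times> W12) \<rightarrow> W21"
| "valid_conference n W12 W21 (Receiver2_First h21 h12) \<longleftrightarrow>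
     h21 \<in> seqs n \<rightarrow> W21 \<and> h12 \<in> (seqs n \<times> W21) \<rightarrow> W12"

record ('x, 'y1, 'y2) bc_code =
  encoder :: "nat \<Rightarrow> nat \<Rightarrow> 'x"
  msgs12 :: "nat set"
  msgs21 :: "nat set"
  conf :: "('y1, 'y2) conference"
  decoder1 :: "nat \<times> (nat \<Rightarrow> 'y1) \<Rightarrow> nat"
  decoder2 :: "nat \<times> (nat \<Rightarrow> 'y2) \<Rightarrow> nat"

definition messages :: "nat \<Rightarrow> real \<Rightarrow> nat set" where
  "messages n R = {1..nat \<lfloor>2 powr (real n * R)\<rfloor>}"

definition is_bc_code ::
  "real \<Rightarrow> real \<Rightarrow> nat \<Rightarrow> real \<Rightarrow> ('x, 'y1, 'y2) bc_code \<Rightarrow> bool" where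
  "is_bc_code C12 C21 n R c \<longleftrightarrow>
     encoder c \<in> messages n R \<rightarrow> seqs n \<and>
     finite (msgs12 c) \<and> real (card (msgs12 c)) \<le> 2 powr (real n * C12) \<and>
     finite (msgs21 c) \<and> real (card (msgs21 c)) \<le> 2 powr (real n * C21) \<and>
     valid_conference n (msgs12 c) (msgs21 c) (conf c) \<and>
     decoder1 c \<in> (msgs21 c \<times> seqs n) \<rightarrow> messages n R \<and>
     decoder2 c \<in> (msgs12 c \<times> seqs n) \<rightarrow> messages n R"

definition error_prob ::
  "('x \<Rightarrow> ('y1 \<times> 'y2) pmf) \<Rightarrow> nat \<Rightarrow> real \<Rightarrow> ('x, 'y1, 'y2) bc_code \<Rightarrow> real" where
  "error_prob ch n R c =
     measure_pmf.prob
       (do { w \<leftarrow> pmf_of_set (messages n R);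
             (y1, y2) \<leftarrow> dmbc ch n (encoder c w);
             return_pmf (w, y1, y2) })
       {(w, y1, y2). let (w12, w21) = conference_messages (conf c) y1 y2
          in decoder1 c (w21, y1) \<noteq> w \<or> decoder2 c (w12, y2) \<noteq> w}"

definition achievable ::
  "('x \<Rightarrow> ('y1 \<times> 'y2) pmf) \<Rightarrow> real \<Rightarrow> real \<Rightarrow> real \<Rightarrow> bool" where
  "achievable ch C12 C21 R \<longleftrightarrow> 0 \<le> R \<and>
     (\<forall>\<delta>>0. \<exists>c. (\<forall>n. is_bc_code C12 C21 n (max (R - \<delta>) 0) (c n)) \<and>
       (\<lambda>n. error_prob ch n (max (R - \<delta>) 0) (c n)) \<longlonglongrightarrow> 0)"

definition joint_pmf ::
  "('x \<Rightarrow> ('y1 \<times> 'y2) pmf) \<Rightarrow> 'x pmf \<Rightarrow> ('x \<times> 'y1 \<times> 'y2) pmf" where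
  "joint_pmf ch p =
     do { x \<leftarrow> p; (y1, y2) \<leftarrow> ch x; return_pmf (x, y1, y2) }"

definition mutual_info_bits :: "'s pmf \<Rightarrow> ('s \<Rightarrow> 'a) \<Rightarrow> ('s \<Rightarrow> 'b) \<Rightarrow> real" where
  "mutual_info_bits q A B =
     prob_space.mutual_information (measure_pmf q) 2 (count_space UNIV) (count_space UNIV) A B"

end

theory Submission
  imports Defs
begin

text \<open>The converse avoids entropies and Fano's inequality. Fix a code, let \<open>p\<close> be its input
  distribution averaged over messages and times, and let \<open>q\<close> be the output distribution that \<open>p\<close>
  induces. The divergence between the true law of the message and the output block and the law
  under which the message is independent of an i.i.d. \<open>q\<close> output is exactly \<open>n I(p)\<close>, so
  single-letterization and concavity come for free. A receiver that learns one of at most \<open>l\<close>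
  conference messages is a list decoder of list size \<open>l\<close>. Under the product law its list contains
  the message with probability at most \<open>l / M\<close>, and the variational inequality for the divergence
  gives \<open>P(success) log (M / l) \<le> n I(p) + 1\<close>. As \<open>p\<close> is the same for the three decoders,
  the three bounds hold simultaneously at one input distribution.\<close>

section \<open>Averaging over messages and change of measure\<close>

lemma measure_bind_pmf_of_set:
  assumes "finite W" "W \<noteq> {}"
  shows "measure_pmf.prob (bind_pmf (pmf_of_set W) f) A =
    (\<Sum>w\<in>W. measure_pmf.prob (f w) A) / card W"
proof -
  have *: "measure_pmf.prob p A = pmf (map_pmf (\<lambda>x. x \<in> A) p) True" for p :: "'b pmf"
    by (simp add: pmf_map vimage_def)
  show ?thesis
    using assms by (simp add: * map_bind_pmf pmf_bind integral_pmf_of_set)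
qed

text \<open>The Donsker--Varadhan inequality with \<open>ln Z\<close> linearized at \<open>Z = 2\<close>, which makes the
  bound affine in \<open>Q\<close> and lets it be averaged over messages.\<close>
lemma change_of_measure:
  fixes P Q :: "'a pmf" and f :: "'a \<Rightarrow> real"
  assumes fin: "finite (set_pmf Q)" and sub: "set_pmf P \<subseteq> set_pmf Q"
  shows "measure_pmf.expectation P f \<le>
    measure_pmf.expectation P (\<lambda>y. ln (pmf P y / pmf Q y)) +
    measure_pmf.expectation Q (\<lambda>y. exp (f y)) / 2 + ln 2 - 1"
proof -
  define A where "A = set_pmf Q"
  have A: "finite A" using fin by (simp add: A_def)
  have P: "measure_pmf.expectation P g = (\<Sum>y\<in>A. g y * pmf P y)" for g
    by (rule integral_measure_pmf_real) (use A sub in \<open>auto simp: A_def\<close>)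
  have Q: "measure_pmf.expectation Q g = (\<Sum>y\<in>A. g y * pmf Q y)" for g
    by (rule integral_measure_pmf_real) (use A in \<open>auto simp: A_def\<close>)
  have P1: "(\<Sum>y\<in>A. pmf P y) = 1"
    using A sub by (intro sum_pmf_eq_1) (auto simp: A_def)
  have pointwise: "f y * pmf P y \<le> ln (pmf P y / pmf Q y) * pmf P y + exp (f y) * pmf Q y / 2
      + (ln 2 - 1) * pmf P y" if "y \<in> A" for y
  proof (cases "pmf P y = 0")
    case False
    then have p: "pmf P y > 0" by (simp add: pmf_pos)
    have q: "pmf Q y > 0" using that by (auto simp: A_def intro: pmf_positive)
    \<comment> \<open>The bound \<open>ln r \<le> r - 1\<close> at this ratio, weighted by
      \<open>pmf P y\<close>, is the claim at one point; the 2 in the denominator is the point of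
      linearization.\<close>
    let ?r = "exp (f y) * pmf Q y / (2 * pmf P y)"
    have "ln ?r \<le> ?r - 1"
      using p q by (intro ln_le_minus_one) simp
    moreover have "ln ?r = f y - ln (pmf P y / pmf Q y) - ln 2"
      using p q by (simp add: ln_mult ln_div)
    ultimately have "f y \<le> ln (pmf P y / pmf Q y) + ?r + (ln 2 - 1)" by simp
    then have "f y * pmf P y \<le> (ln (pmf P y / pmf Q y) + ?r + (ln 2 - 1)) * pmf P y"
      using p by (intro mult_right_mono) auto
    also have "\<dots> = ln (pmf P y / pmf Q y) * pmf P y + exp (f y) * pmf Q y / 2 + (ln 2 - 1) * pmf P y"
      using p by (simp add: distrib_right)
    finally show ?thesis .
  qed simp
  have "(\<Sum>y\<in>A. f y * pmf P y) \<le> (\<Sum>y\<in>A. ln (pmf P y / pmf Q y) * pmf P y +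
      exp (f y) * pmf Q y / 2 + (ln 2 - 1) * pmf P y)"
    by (rule sum_mono) (rule pointwise)
  also have "\<dots> = (\<Sum>y\<in>A. ln (pmf P y / pmf Q y) * pmf P y) +
      (\<Sum>y\<in>A. exp (f y) * pmf Q y) / 2 + (ln 2 - 1) * (\<Sum>y\<in>A. pmf P y)"
    by (simp add: sum.distrib sum_distrib_left sum_divide_distrib)
  finally show ?thesis by (simp add: P Q P1)
qed

section \<open>Mutual information of a finite channel\<close>

text \<open>Mutual information in bits, written as the average under \<open>p\<close> of the
  divergence of \<open>K x\<close> from the induced output law. This is the form in which the sums
  over messages and times appear.\<close>

definition channel_info :: "'x::finite pmf \<Rightarrow> ('x \<Rightarrow> 'y::finite pmf) \<Rightarrow> real" where
  "channel_info p K = (\<Sum>x\<in>UNIV. \<Sum>y\<in>UNIV.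
     pmf p x * pmf (K x) y * log 2 (pmf (K x) y / pmf (bind_pmf p K) y))"

lemma mutual_information_pmf:
  fixes q :: "'s pmf" and A :: "'s \<Rightarrow> 'a::finite" and B :: "'s \<Rightarrow> 'b::finite"
  shows "mutual_info_bits q A B = (\<Sum>a\<in>UNIV. \<Sum>b\<in>UNIV. pmf (map_pmf (\<lambda>s. (A s, B s)) q) (a, b) *
     log 2 (pmf (map_pmf (\<lambda>s. (A s, B s)) q) (a, b) / (pmf (map_pmf A q) a * pmf (map_pmf B q) b)))"
proof -
  interpret information_space "measure_pmf q" 2 by unfold_locales simp
  have D: "distributed (measure_pmf q) (count_space UNIV) X (pmf (map_pmf X q))" for X :: "'s \<Rightarrow> 'c"
    by (simp add: distributed_def flip: measure_pmf_eq_density map_pmf_rep_eq)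
  have pair: "count_space (UNIV::'a set) \<Otimes>\<^sub>M count_space (UNIV::'b set) = count_space UNIV"
    by (simp add: pair_measure_countable)
  have "mutual_info_bits q A B = (\<integral>z. pmf (map_pmf (\<lambda>s. (A s, B s)) q) z *
     log 2 (pmf (map_pmf (\<lambda>s. (A s, B s)) q) z / (pmf (map_pmf A q) (fst z) * pmf (map_pmf B q) (snd z)))
     \<partial>(count_space (UNIV::'a set) \<Otimes>\<^sub>M count_space (UNIV::'b set)))"
    unfolding mutual_info_bits_def
    by (rule mutual_information_distr)
      (auto simp: D pair intro: sigma_finite_measure_count_space_finite)
  also have "\<dots> = (\<Sum>z\<in>UNIV \<times> UNIV. pmf (map_pmf (\<lambda>s. (A s, B s)) q) z *
     log 2 (pmf (map_pmf (\<lambda>s. (A s, B s)) q) z / (pmf (map_pmf A q) (fst z) * pmf (map_pmf B q) (snd z))))"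
    by (simp add: pair lebesgue_integral_count_space_finite)
  finally show ?thesis by (simp add: sum.cartesian_product split_beta)
qed

text \<open>The joint law factors, so \<open>pmf p x\<close> cancels inside the logarithm. A general
  \<open>h\<close> covers both single outputs and the output pair at once.\<close>

lemma mutual_info_joint_pmf:
  fixes ch :: "'x::finite \<Rightarrow> ('y1::finite \<times> 'y2::finite) pmf" and h :: "'y1 \<times> 'y2 \<Rightarrow> 'z::finite"
  shows "mutual_info_bits (joint_pmf ch p) (\<lambda>(x, y1, y2). x) (\<lambda>(x, y1, y2). h (y1, y2)) =
    channel_info p (\<lambda>x. map_pmf h (ch x))"
proof -
  let ?q = "joint_pmf ch p" and ?A = "\<lambda>(x :: 'x, y1 :: 'y1, y2 :: 'y2). x"
    and ?B = "\<lambda>(x :: 'x, y1, y2). h (y1, y2)" and ?K = "\<lambda>x. map_pmf h (ch x)"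
  have q: "?q = bind_pmf p (\<lambda>x. map_pmf (Pair x) (ch x))"
    by (simp add: joint_pmf_def map_pmf_def split_def)
  have A: "map_pmf ?A ?q = p"
    by (simp add: q map_bind_pmf pmf.map_comp comp_def split_beta bind_return_pmf' map_pmf_const)
  have B: "map_pmf ?B ?q = bind_pmf p ?K"
    by (simp add: q map_bind_pmf pmf.map_comp comp_def split_beta)
  have "map_pmf (\<lambda>s. (?A s, ?B s)) ?q = bind_pmf p (\<lambda>x. map_pmf (Pair x) (?K x))"
    by (simp add: q map_bind_pmf pmf.map_comp comp_def split_beta)
  moreover have "pmf (bind_pmf p (\<lambda>x. map_pmf (Pair x) (?K x))) (x, z) = pmf p x * pmf (?K x) z"
    for x z
  proof -
    have pair: "pmf (map_pmf (Pair x') (?K x')) (x, z) = (if x' = x then pmf (?K x) z else 0)" for x'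
    proof (cases "x' = x")
      case True
      then show ?thesis by (simp add: pmf_map_inj' inj_on_def)
    next
      case False
      then show ?thesis by (subst pmf_map_outside) auto
    qed
    have "pmf (bind_pmf p (\<lambda>x. map_pmf (Pair x) (?K x))) (x, z) =
        (\<Sum>x'\<in>UNIV. pmf (map_pmf (Pair x') (?K x')) (x, z) * pmf p x')"
      by (simp add: pmf_bind integral_measure_pmf_real[of UNIV])
    also have "\<dots> = (\<Sum>x'\<in>UNIV. if x' = x then pmf p x * pmf (?K x) z else 0)"
      by (intro sum.cong refl) (auto simp: pair)
    finally show ?thesis by simp
  qed
  ultimately have AB: "pmf (map_pmf (\<lambda>s. (?A s, ?B s)) ?q) (x, z) = pmf p x * pmf (?K x) z" for x z
    by simp
  show ?thesis
    unfolding mutual_information_pmf AB A B channel_info_def by (intro sum.cong refl) simp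
qed

text \<open>A crude bound that makes the final supremum finite. Since
  \<open>pmf p x * pmf (K x) y\<close> is at most the output probability, the log ratio is at most
  \<open>ln (1 / pmf p x)\<close>, and \<open>s * ln (1 / s) \<le> 1\<close> for
  \<open>s > 0\<close>.\<close>

lemma channel_info_le:
  fixes p :: "'x::finite pmf" and K :: "'x \<Rightarrow> 'y::finite pmf"
  shows "channel_info p K \<le> real (CARD('x)) / ln 2"
proof -
  have term_le: "pmf p x * pmf (K x) y * log 2 (pmf (K x) y / pmf (bind_pmf p K) y)
      \<le> pmf (K x) y / ln 2" for x y
  proof (cases "pmf p x * pmf (K x) y = 0")
    case True
    then show ?thesis by (auto simp: field_simps)
  next
    case False
    then have pos: "pmf p x > 0" "pmf (K x) y > 0" by (simp_all add: pmf_pos)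
    have "pmf p x * pmf (K x) y \<le> (\<Sum>x'\<in>UNIV. pmf (K x') y * pmf p x')"
      using member_le_sum[of x UNIV "\<lambda>x'. pmf (K x') y * pmf p x'"] by (simp add: mult.commute)
    also have "\<dots> = pmf (bind_pmf p K) y"
      by (simp add: pmf_bind integral_measure_pmf_real[of UNIV])
    finally have q: "pmf p x * pmf (K x) y \<le> pmf (bind_pmf p K) y" .
    then have q0: "pmf (bind_pmf p K) y > 0" using pos by (meson less_le_trans mult_pos_pos)
    have "ln (pmf (K x) y / pmf (bind_pmf p K) y) \<le> ln (1 / pmf p x)"
      using pos q q0 by (subst ln_le_cancel_iff) (auto simp: field_simps)
    also have "\<dots> \<le> 1 / pmf p x - 1"
      using pos by (intro ln_le_minus_one) simp
    finally have "pmf p x * ln (pmf (K x) y / pmf (bind_pmf p K) y) \<le> pmf p x * (1 / pmf p x)"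
      using pos by (intro mult_left_mono) auto
    then have "pmf (K x) y * (pmf p x * ln (pmf (K x) y / pmf (bind_pmf p K) y)) \<le> pmf (K x) y * 1"
      using pos by (intro mult_left_mono) auto
    then have "pmf (K x) y * (pmf p x * ln (pmf (K x) y / pmf (bind_pmf p K) y)) / ln 2
        \<le> pmf (K x) y / ln 2"
      by (intro divide_right_mono) auto
    then show ?thesis by (simp add: log_def mult_ac)
  qed
  have "channel_info p K \<le> (\<Sum>x::'x\<in>UNIV. \<Sum>y\<in>UNIV. pmf (K x) y / ln 2)"
    unfolding channel_info_def by (intro sum_mono term_le)
  also have "\<dots> = real (CARD('x)) / ln 2"
    by (simp add: sum_pmf_eq_1 flip: sum_divide_distrib)
  finally show ?thesis .
qed

section \<open>Single-letter input law and divergence of product laws\<close>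

text \<open>The usual time-sharing index is absorbed into the input law, so no auxiliary variable
  has to be removed by concavity later.\<close>

definition average_input :: "nat \<Rightarrow> 'w set \<Rightarrow> ('w \<Rightarrow> nat \<Rightarrow> 'x) \<Rightarrow> 'x pmf" where
  "average_input n W e = map_pmf (\<lambda>(w, i). e w i) (pmf_of_set (W \<times> {..<n}))"

lemma expectation_average_input:
  assumes "finite W" "W \<noteq> {}" "n > 0"
  shows "measure_pmf.expectation (average_input n W e) g =
    (\<Sum>w\<in>W. \<Sum>i<n. g (e w i)) / (card W * n)"
  using assms
  by (subst average_input_def)
    (simp add: integral_pmf_of_set sum.cartesian_product split_beta lessThan_empty_iff)

lemma set_pmf_average_input:
  assumes "finite W" "W \<noteq> {}" "n > 0"
  shows "set_pmf (average_input n W e) = (\<lambda>(w, i). e w i) ` (W \<times> {..<n})"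
  using assms by (subst average_input_def) (simp add: lessThan_empty_iff)

lemma finite_set_Pi_pmf:
  fixes p :: "'i \<Rightarrow> 'a::finite pmf"
  assumes "finite A"
  shows "finite (set_pmf (Pi_pmf A d p))"
  using assms by (auto simp: set_Pi_pmf)

text \<open>Divergence is additive over product laws: on the support all factors are positive, so
  the logarithm splits into summands that each see one marginal.\<close>

lemma expectation_ln_ratio_Pi_pmf:
  fixes p q :: "'i \<Rightarrow> 'a::finite pmf"
  assumes A: "finite A" and sub: "\<And>i. i \<in> A \<Longrightarrow> set_pmf (p i) \<subseteq> set_pmf (q i)"
  shows "measure_pmf.expectation (Pi_pmf A d p) (\<lambda>y. ln (pmf (Pi_pmf A d p) y / pmf (Pi_pmf A d q) y)) =
    (\<Sum>i\<in>A. measure_pmf.expectation (p i) (\<lambda>z. ln (pmf (p i) z / pmf (q i) z)))"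
proof -
  let ?P = "Pi_pmf A d p" and ?Q = "Pi_pmf A d q"
  have "measure_pmf.expectation ?P (\<lambda>y. ln (pmf ?P y / pmf ?Q y)) =
      measure_pmf.expectation ?P (\<lambda>y. \<Sum>i\<in>A. ln (pmf (p i) (y i) / pmf (q i) (y i)))"
  proof (rule integral_cong_AE)
    have "ln (pmf ?P y / pmf ?Q y) = (\<Sum>i\<in>A. ln (pmf (p i) (y i) / pmf (q i) (y i)))"
      if "y \<in> set_pmf ?P" for y
    proof -
      have y: "\<And>i. i \<notin> A \<Longrightarrow> y i = d" "\<And>i. i \<in> A \<Longrightarrow> y i \<in> set_pmf (p i)"
        using that A by (auto simp: set_Pi_pmf PiE_dflt_def)
      have "0 < pmf (p i) (y i)" "0 < pmf (q i) (y i)" if "i \<in> A" for i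
        using y(2)[OF that] sub[OF that] by (auto intro: pmf_positive)
      then show ?thesis
        using A y(1) by (simp add: pmf_Pi flip: prod_dividef) (subst ln_prod; force)
    qed
    then show "AE y in ?P. ln (pmf ?P y / pmf ?Q y) = (\<Sum>i\<in>A. ln (pmf (p i) (y i) / pmf (q i) (y i)))"
      by (simp add: AE_measure_pmf_iff)
  qed auto
  also have "\<dots> = (\<Sum>i\<in>A. measure_pmf.expectation ?P (\<lambda>y. ln (pmf (p i) (y i) / pmf (q i) (y i))))"
    using A by (intro Bochner_Integration.integral_sum integrable_measure_pmf_finite finite_set_Pi_pmf)
  also have "\<dots> = (\<Sum>i\<in>A. measure_pmf.expectation (p i) (\<lambda>z. ln (pmf (p i) z / pmf (q i) z)))"
  proof (rule sum.cong[OF refl])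
    fix i assume "i \<in> A"
    show "measure_pmf.expectation ?P (\<lambda>y. ln (pmf (p i) (y i) / pmf (q i) (y i))) =
        measure_pmf.expectation (p i) (\<lambda>z. ln (pmf (p i) z / pmf (q i) z))"
      using integral_map_pmf[of "\<lambda>y. y i" ?P "\<lambda>z. ln (pmf (p i) z / pmf (q i) z)"] A \<open>i \<in> A\<close>
      by (simp add: Pi_pmf_component del: integral_map_pmf)
  qed
  finally show ?thesis .
qed

section \<open>Converse for list decoding\<close>

text \<open>For each message, \<open>change_of_measure\<close> is applied to \<open>t\<close> times
  the indicator that the list contains it, and the results are summed. With
  \<open>t = ln (card W / l)\<close> the \<open>Q\<close>-expectations average to at most 2, the
  point of linearization, so the constants total \<open>ln 2\<close> per message: the 1 bit on the
  right.\<close>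

lemma list_decoding_bound:
  fixes K :: "'x::finite \<Rightarrow> 'y::finite pmf" and e :: "'w \<Rightarrow> nat \<Rightarrow> 'x" and L :: "(nat \<Rightarrow> 'y) \<Rightarrow> 'w set"
  assumes W: "finite W" "W \<noteq> {}" and n: "n > 0" and l: "l > 0"
    and L: "\<And>y. real (card (W \<inter> L y)) \<le> l"
  shows "(\<Sum>w\<in>W. measure_pmf.prob (Pi_pmf {..<n} d (\<lambda>i. K (e w i))) {y. w \<in> L y}) / card W
      * log 2 (card W / l) \<le> n * channel_info (average_input n W e) K + 1"
proof -
  let ?p = "average_input n W e"
  define q where "q = bind_pmf ?p K"
  define P where "P = (\<lambda>w. Pi_pmf {..<n} d (\<lambda>i. K (e w i)))"
  define Q where "Q = Pi_pmf {..<n} d (\<lambda>_. q)"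
  define M where "M = real (card W)"
  define t where "t = ln (M / l)"
  define D where "D = (\<lambda>x. measure_pmf.expectation (K x) (\<lambda>z. ln (pmf (K x) z / pmf q z)))"
  have M: "M > 0" using W by (simp add: M_def card_gt_0_iff)
  \<comment> \<open>Every transmitted letter has positive weight in \<open>?p\<close>, which gives
    the absolute continuity that the divergences need.\<close>
  have sub: "set_pmf (K (e w i)) \<subseteq> set_pmf q" if "w \<in> W" "i < n" for w i
    using that W n by (force simp: q_def set_pmf_average_input)
  \<comment> \<open>The average input weighs all pairs of message and time equally, so this is an
    equality; \<open>ln 2\<close> converts bits to nats.\<close>
  have D: "(\<Sum>w\<in>W. \<Sum>i<n. D (e w i)) = M * n * (channel_info ?p K * ln 2)"
  proof -
    have "channel_info ?p K * ln 2 = (\<Sum>x\<in>UNIV. pmf ?p x * D x)"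
      by (simp add: channel_info_def D_def integral_measure_pmf_real[of UNIV] log_def q_def
          sum_distrib_left sum_distrib_right mult_ac)
    also have "\<dots> = measure_pmf.expectation ?p D"
      by (simp add: integral_measure_pmf_real[of UNIV] mult_ac)
    also have "\<dots> = (\<Sum>w\<in>W. \<Sum>i<n. D (e w i)) / (M * n)"
      using W n by (simp add: expectation_average_input M_def)
    finally show ?thesis using M n by (simp add: field_simps)
  qed
  have bound: "t * measure_pmf.prob (P w) {y. w \<in> L y} \<le> (\<Sum>i<n. D (e w i)) +
      (1 + exp t * measure_pmf.prob Q {y. w \<in> L y}) / 2 + ln 2 - 1" if "w \<in> W" for w
  proof -
    let ?f = "\<lambda>y. t * indicator {y. w \<in> L y} y"
    have fin: "finite (set_pmf (P w))" "finite (set_pmf Q)"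
      by (simp_all add: P_def Q_def finite_set_Pi_pmf)
    have "measure_pmf.expectation (P w) ?f \<le>
        measure_pmf.expectation (P w) (\<lambda>y. ln (pmf (P w) y / pmf Q y)) +
        measure_pmf.expectation Q (\<lambda>y. exp (?f y)) / 2 + ln 2 - 1"
      using sub[OF that] fin
      by (intro change_of_measure) (auto simp: P_def Q_def set_Pi_pmf PiE_dflt_def)
    also have "measure_pmf.expectation (P w) (\<lambda>y. ln (pmf (P w) y / pmf Q y)) = (\<Sum>i<n. D (e w i))"
      unfolding P_def Q_def D_def using sub[OF that] by (intro expectation_ln_ratio_Pi_pmf) auto
    \<comment> \<open>The exponential is replaced by an affine function of the indicator, valid for
      either sign of \<open>t\<close>.\<close>
    also have "measure_pmf.expectation Q (\<lambda>y. exp (?f y)) \<le>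
        measure_pmf.expectation Q (\<lambda>y. 1 + exp t * indicator {y. w \<in> L y} y)"
      by (intro integral_mono integrable_measure_pmf_finite fin) (auto simp: indicator_def)
    also have "\<dots> = 1 + exp t * measure_pmf.prob Q {y. w \<in> L y}"
      by (subst Bochner_Integration.integral_add) (auto intro: integrable_measure_pmf_finite fin)
    finally show ?thesis by simp
  qed
  \<comment> \<open>\<open>Q\<close> does not depend on \<open>w\<close>, so sum and expectation can
    be exchanged; the integrand is then the list size.\<close>
  have Qsum: "(\<Sum>w\<in>W. measure_pmf.prob Q {y. w \<in> L y}) \<le> l"
  proof -
    have fin: "finite (set_pmf Q)" by (simp add: Q_def finite_set_Pi_pmf)
    have "(\<Sum>w\<in>W. measure_pmf.prob Q {y. w \<in> L y}) =
        measure_pmf.expectation Q (\<lambda>y. \<Sum>w\<in>W. indicator {y. w \<in> L y} y)"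
      by (subst Bochner_Integration.integral_sum) (auto intro: integrable_measure_pmf_finite fin)
    also have "\<dots> = measure_pmf.expectation Q (\<lambda>y. real (card (W \<inter> L y)))"
      using W by (simp add: indicator_def flip: sum.inter_filter)
    also have "\<dots> \<le> measure_pmf.expectation Q (\<lambda>y. l)"
      by (intro integral_mono integrable_measure_pmf_finite fin L)
    finally show ?thesis by simp
  qed
  have "t * (\<Sum>w\<in>W. measure_pmf.prob (P w) {y. w \<in> L y}) \<le> (\<Sum>w\<in>W. (\<Sum>i<n. D (e w i)) +
      (1 + exp t * measure_pmf.prob Q {y. w \<in> L y}) / 2 + ln 2 - 1)"
    unfolding sum_distrib_left by (rule sum_mono) (rule bound)
  also have "\<dots> = (\<Sum>w\<in>W. \<Sum>i<n. D (e w i)) + M * (1 / 2 + ln 2 - 1)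
      + exp t * (\<Sum>w\<in>W. measure_pmf.prob Q {y. w \<in> L y}) / 2"
    by (simp add: sum.distrib sum_subtractf sum_distrib_left sum_divide_distrib M_def algebra_simps
        add_divide_distrib)
  also have "\<dots> \<le> M * n * (channel_info ?p K * ln 2) + M * (1 / 2 + ln 2 - 1) + exp t * l / 2"
    using Qsum by (simp add: D)
  also have "exp t * l = M" using M l by (simp add: t_def)
  finally have "t * (\<Sum>w\<in>W. measure_pmf.prob (P w) {y. w \<in> L y})
      \<le> (n * channel_info ?p K + 1) * (M * ln 2)"
    by (simp add: algebra_simps)
  then have "(\<Sum>w\<in>W. measure_pmf.prob (P w) {y. w \<in> L y}) / M * (t / ln 2)
      \<le> n * channel_info ?p K + 1"
    using M by (simp add: field_simps)
  then show ?thesis by (simp add: P_def M_def t_def log_def)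
qed

text \<open>Transfers the list bound to a decoder that sees only \<open>h\<close> of each output
  letter, while the success event \<open>G\<close> may depend on the full outputs. Letterwise images
  of a product law are again product laws.\<close>

lemma list_decoding_bound_observation:
  fixes ch :: "'x::finite \<Rightarrow> 'y::finite pmf" and h :: "'y \<Rightarrow> 'z::finite"
    and e :: "'w \<Rightarrow> nat \<Rightarrow> 'x" and L :: "(nat \<Rightarrow> 'z) \<Rightarrow> 'w set"
  assumes W: "finite W" "W \<noteq> {}" and n: "n > 0" and l: "l > 0"
    and L: "\<And>z. real (card (W \<inter> L z)) \<le> l"
    and G: "\<And>w y. w \<in> W \<Longrightarrow> G w y \<Longrightarrow> w \<in> L (h \<circ> y)"
  shows "(\<Sum>w\<in>W. measure_pmf.prob (Pi_pmf {..<n} d (\<lambda>i. ch (e w i))) {y. G w y}) / card W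
      * log 2 (card W / l) \<le> n * channel_info (average_input n W e) (\<lambda>x. map_pmf h (ch x)) + 1"
    (is "?s / _ * ?t \<le> ?I")
proof (cases "?t \<ge> 0")
  \<comment> \<open>Enlarging success to the list event preserves the inequality because the
    logarithmic factor is nonnegative here.\<close>
  case True
  let ?K = "\<lambda>x. map_pmf h (ch x)"
  \<comment> \<open>The default letter is mapped as well, hence \<open>h d\<close>, as
    \<open>Pi_pmf_map\<close> requires.\<close>
  let ?s' = "\<Sum>w\<in>W. measure_pmf.prob (Pi_pmf {..<n} (h d) (\<lambda>i. ?K (e w i))) {z. w \<in> L z}"
  have "?s \<le> ?s'"
  proof (rule sum_mono)
    fix w assume w: "w \<in> W"
    have "measure_pmf.prob (Pi_pmf {..<n} d (\<lambda>i. ch (e w i))) {y. G w y} \<le>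
        measure_pmf.prob (Pi_pmf {..<n} d (\<lambda>i. ch (e w i))) {y. w \<in> L (h \<circ> y)}"
      using G[OF w] by (intro measure_pmf.finite_measure_mono) auto
    then show "measure_pmf.prob (Pi_pmf {..<n} d (\<lambda>i. ch (e w i))) {y. G w y} \<le>
        measure_pmf.prob (Pi_pmf {..<n} (h d) (\<lambda>i. ?K (e w i))) {z. w \<in> L z}"
      by (simp add: Pi_pmf_map[where dflt = d] vimage_def)
  qed
  then have "?s / card W * ?t \<le> ?s' / card W * ?t"
    using True by (intro mult_right_mono divide_right_mono) auto
  also have "\<dots> \<le> ?I"
    by (rule list_decoding_bound) (use W n l L in auto)
  finally show ?thesis .
next
  case False
  have "?s / card W * ?t \<le> 0"
    using False by (intro mult_nonneg_nonpos divide_nonneg_nonneg sum_nonneg) auto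
  \<comment> \<open>With the list equal to all of \<open>W\<close> the logarithm is 0, so the list
    bound itself shows that the right side is nonnegative.\<close>
  also have "0 \<le> ?I"
    using list_decoding_bound[of W n "real (card W)" "\<lambda>_. W"] W n by (simp add: card_gt_0_iff)
  finally show ?thesis .
qed

section \<open>Success probability and rate of a code\<close>

definition correct :: "('x, 'y1, 'y2) bc_code \<Rightarrow> nat \<Rightarrow> (nat \<Rightarrow> 'y1) \<Rightarrow> (nat \<Rightarrow> 'y2) \<Rightarrow> bool" where
  "correct c w y1 y2 \<longleftrightarrow>
     decoder1 c (snd (conference_messages (conf c) y1 y2), y1) = w \<and>
     decoder2 c (fst (conference_messages (conf c) y1 y2), y2) = w"

lemma finite_messages [simp]: "finite (messages n R)"
  by (simp add: messages_def)

lemma messages_nonempty: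
  assumes "R \<ge> 0"
  shows "messages n R \<noteq> {}"
proof -
  have "2 powr (real n * R) \<ge> 1" using assms by (intro ge_one_powr_ge_zero) auto
  then have "\<lfloor>2 powr (real n * R)\<rfloor> \<ge> 1" by (simp add: le_floor_iff)
  then show ?thesis by (simp add: messages_def le_nat_iff)
qed

text \<open>Rounding down costs at most one bit: the floor of \<open>z \<ge> 1\<close> is at least
  \<open>z / 2\<close>.\<close>

lemma log_card_messages_ge:
  assumes "R \<ge> 0"
  shows "log 2 (card (messages n R)) \<ge> real n * R - 1"
proof -
  define z where "z = 2 powr (real n * R)"
  have "z \<ge> 1" using assms unfolding z_def by (intro ge_one_powr_ge_zero) auto
  then have floor: "\<lfloor>z\<rfloor> \<ge> 1" by (simp add: le_floor_iff)
  then have "z / 2 \<le> of_int \<lfloor>z\<rfloor>" using floor_correct[of z] by linarith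
  with floor have "z / 2 \<le> real (card (messages n R))" by (simp add: messages_def z_def)
  then have "log 2 (z / 2) \<le> log 2 (card (messages n R))"
    using \<open>z \<ge> 1\<close> by (subst log_le_cancel_iff) auto
  then show ?thesis by (simp add: z_def log_divide)
qed

lemma one_minus_error_prob:
  assumes "R \<ge> 0"
  shows "1 - error_prob ch n R c = (\<Sum>w\<in>messages n R. measure_pmf.prob
      (Pi_pmf {..<n} undefined (\<lambda>i. ch (encoder c w i)))
      {y. correct c w (\<lambda>i\<in>{..<n}. fst (y i)) (\<lambda>i\<in>{..<n}. snd (y i))}) / card (messages n R)"
proof -
  let ?W = "messages n R"
  let ?P = "\<lambda>w. Pi_pmf {..<n} undefined (\<lambda>i. ch (encoder c w i))"
  let ?G = "\<lambda>w. {y. correct c w (\<lambda>i\<in>{..<n}. fst (y i)) (\<lambda>i\<in>{..<n}. snd (y i))}"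
  have "error_prob ch n R c = (\<Sum>w\<in>?W. measure_pmf.prob (?P w) (- ?G w)) / card ?W"
    unfolding error_prob_def
  proof (subst measure_bind_pmf_of_set)
    let ?E = "{(w, y1, y2). let (w12, w21) = conference_messages (conf c) y1 y2
      in decoder1 c (w21, y1) \<noteq> w \<or> decoder2 c (w12, y2) \<noteq> w}"
    have "dmbc ch n (encoder c w) \<bind> (\<lambda>(y1, y2). return_pmf (w, y1, y2)) =
        map_pmf (\<lambda>y. (w, \<lambda>i\<in>{..<n}. fst (y i), \<lambda>i\<in>{..<n}. snd (y i))) (?P w)" for w
      by (simp add: dmbc_def map_pmf_def bind_assoc_pmf bind_return_pmf)
    moreover have "(\<lambda>y. (w, \<lambda>i\<in>{..<n}. fst (y i), \<lambda>i\<in>{..<n}. snd (y i))) -` ?E = - ?G w" for w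
      by (auto simp: correct_def split_beta)
    ultimately show "(\<Sum>w\<in>?W. measure_pmf.prob
        (dmbc ch n (encoder c w) \<bind> (\<lambda>(y1, y2). return_pmf (w, y1, y2))) ?E) / card ?W =
      (\<Sum>w\<in>?W. measure_pmf.prob (?P w) (- ?G w)) / card ?W"
      by simp
  qed (simp_all add: messages_nonempty[OF assms])
  also have "\<dots> = (\<Sum>w\<in>?W. 1 - measure_pmf.prob (?P w) (?G w)) / card ?W"
    by (simp add: measure_pmf.prob_compl[simplified] Compl_eq_Diff_UNIV)
  also have "\<dots> = 1 - (\<Sum>w\<in>?W. measure_pmf.prob (?P w) (?G w)) / card ?W"
    using messages_nonempty[OF assms] by (simp add: sum_subtractf diff_divide_distrib)
  finally show ?thesis by simp
qed

text \<open>The list bound with list size \<open>2 powr (real n * C)\<close>. Of the loss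
  \<open>2 / real n\<close>, one bit comes from rounding the message set and one from the list
  bound.\<close>

lemma rate_bound:
  fixes ch :: "'x::finite \<Rightarrow> ('y1::finite \<times> 'y2::finite) pmf" and h :: "'y1 \<times> 'y2 \<Rightarrow> 'z::finite"
    and c :: "('x, 'y1, 'y2) bc_code"
  assumes n: "n > 0" and R: "R \<ge> 0" and C: "C \<ge> 0"
    and L: "\<And>z. real (card (messages n R \<inter> L z)) \<le> 2 powr (real n * C)"
    and correct: "\<And>w y. correct c w (\<lambda>i\<in>{..<n}. fst (y i)) (\<lambda>i\<in>{..<n}. snd (y i)) \<Longrightarrow>
      w \<in> L (h \<circ> y)"
  shows "R * (1 - error_prob ch n R c) - 2 / real n \<le>
    channel_info (average_input n (messages n R) (encoder c)) (\<lambda>x. map_pmf h (ch x)) + C"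
    (is "_ \<le> ?I + C")
proof -
  define \<epsilon> where "\<epsilon> = error_prob ch n R c"
  have \<epsilon>: "0 \<le> \<epsilon>" "\<epsilon> \<le> 1" by (auto simp: \<epsilon>_def error_prob_def)
  have card: "card (messages n R) > 0"
    using messages_nonempty[OF R] by (simp add: card_gt_0_iff)
  have "real n * (R - C) - 1 \<le> log 2 (card (messages n R) / 2 powr (real n * C))"
    using log_card_messages_ge[OF R, of n] card messages_nonempty[OF R]
    by (simp add: log_divide algebra_simps)
  then have "(1 - \<epsilon>) * (real n * (R - C) - 1) \<le>
      (1 - \<epsilon>) * log 2 (card (messages n R) / 2 powr (real n * C))"
    using \<epsilon> by (intro mult_left_mono) auto
  also have "\<dots> \<le> n * ?I + 1"
    unfolding \<epsilon>_def one_minus_error_prob[OF R]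
    by (rule list_decoding_bound_observation[where L = L])
      (use messages_nonempty[OF R] n L correct in auto)
  finally have "(1 - \<epsilon>) * (real n * (R - C)) \<le> n * ?I + 2"
    using \<epsilon> by (simp add: algebra_simps)
  \<comment> \<open>\<open>C\<close> arrives with the factor \<open>1 - \<epsilon>\<close>, which
    can be raised to 1 because \<open>C\<close> is nonnegative.\<close>
  moreover have "real n * \<epsilon> * C \<ge> 0" using \<epsilon> C by simp
  ultimately have "R * (1 - \<epsilon>) * n \<le> (?I + C) * n + 2"
    by (simp add: algebra_simps)
  then show ?thesis using n by (simp add: field_simps \<epsilon>_def)
qed

section \<open>Conference messages and the three simultaneous bounds\<close>

text \<open>The order of the conference is examined only here: in either order the first message is
  a legitimate argument for the second map.\<close>

lemma conference_messages_mem: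
  assumes "valid_conference n W12 W21 k" "y1 \<in> seqs n" "y2 \<in> seqs n"
  shows "fst (conference_messages k y1 y2) \<in> W12" "snd (conference_messages k y1 y2) \<in> W21"
  using assms by (cases k; force)+

lemma card_list_le:
  assumes "finite V"
  shows "card (W \<inter> (\<lambda>m. f (m, y)) ` V) \<le> card V"
  using assms by (meson Int_lower2 card_image_le card_mono finite_imageI le_trans)

text \<open>Three list decoders give the three bounds: receiver 1 trying every \<open>W21\<close>,
  receiver 2 trying every \<open>W12\<close>, and a decoder of both outputs that computes the
  conference itself and so lists a single message.\<close>

lemma min_rate_bound:
  fixes ch :: "'x::finite \<Rightarrow> ('y1::finite \<times> 'y2::finite) pmf" and c :: "('x, 'y1, 'y2) bc_code"
  assumes code: "is_bc_code C12 C21 n R c" and n: "n > 0" and R: "R \<ge> 0"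
    and C: "C12 \<ge> 0" "C21 \<ge> 0"
  defines "p \<equiv> average_input n (messages n R) (encoder c)"
  shows "R * (1 - error_prob ch n R c) - 2 / real n \<le>
    min (channel_info p (\<lambda>x. map_pmf fst (ch x)) + C21)
      (min (channel_info p (\<lambda>x. map_pmf snd (ch x)) + C12) (channel_info p ch))"
proof -
  \<comment> \<open>Lists are needed for arbitrary functions, but \<open>conf c\<close> is
    constrained only on \<open>seqs n\<close>; restriction brings any function into that
    set.\<close>
  let ?y1 = "\<lambda>y :: nat \<Rightarrow> 'y1. \<lambda>i\<in>{..<n}. y i" and ?y2 = "\<lambda>y :: nat \<Rightarrow> 'y2. \<lambda>i\<in>{..<n}. y i"
  have seqs: "?y1 y \<in> seqs n" "?y2 z \<in> seqs n" for y z by (auto simp: seqs_def)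
  have V: "valid_conference n (msgs12 c) (msgs21 c) (conf c)"
    and fin: "finite (msgs12 c)" "finite (msgs21 c)"
    and card: "real (card (msgs12 c)) \<le> 2 powr (real n * C12)"
      "real (card (msgs21 c)) \<le> 2 powr (real n * C21)"
    using code by (auto simp: is_bc_code_def)
  note mem = conference_messages_mem[OF V seqs]
  have 1: "R * (1 - error_prob ch n R c) - 2 / real n \<le>
      channel_info p (\<lambda>x. map_pmf fst (ch x)) + C21"
    unfolding p_def
  proof (rule rate_bound[OF n R C(2), where L = "\<lambda>y. (\<lambda>m. decoder1 c (m, ?y1 y)) ` msgs21 c"])
    show "real (card (messages n R \<inter> (\<lambda>m. decoder1 c (m, ?y1 y)) ` msgs21 c)) \<le> 2 powr (real n * C21)" for y
      by (rule order_trans[OF of_nat_mono[OF card_list_le[OF fin(2)]] card(2)])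
  qed (use mem(2) in \<open>auto simp: correct_def comp_def\<close>)
  have 2: "R * (1 - error_prob ch n R c) - 2 / real n \<le>
      channel_info p (\<lambda>x. map_pmf snd (ch x)) + C12"
    unfolding p_def
  proof (rule rate_bound[OF n R C(1), where L = "\<lambda>y. (\<lambda>m. decoder2 c (m, ?y2 y)) ` msgs12 c"])
    show "real (card (messages n R \<inter> (\<lambda>m. decoder2 c (m, ?y2 y)) ` msgs12 c)) \<le> 2 powr (real n * C12)" for y
      by (rule order_trans[OF of_nat_mono[OF card_list_le[OF fin(1)]] card(1)])
    fix w y assume "correct c w (\<lambda>i\<in>{..<n}. fst (y i)) (\<lambda>i\<in>{..<n}. snd (y i))"
    then have "w = decoder2 c (fst (conference_messages (conf c) (\<lambda>i\<in>{..<n}. fst (y i))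
        (\<lambda>i\<in>{..<n}. snd (y i))), ?y2 (snd \<circ> y))"
      by (simp add: correct_def comp_def)
    then show "w \<in> (\<lambda>m. decoder2 c (m, ?y2 (snd \<circ> y))) ` msgs12 c"
      using mem(1) by (rule image_eqI)
  qed
  let ?L = "\<lambda>y. {decoder1 c (snd (conference_messages (conf c) (?y1 (fst \<circ> y)) (?y2 (snd \<circ> y))), ?y1 (fst \<circ> y))}"
  have "R * (1 - error_prob ch n R c) - 2 / real n \<le>
      channel_info p (\<lambda>x. map_pmf (\<lambda>y. y) (ch x)) + 0"
    unfolding p_def
  proof (rule rate_bound[OF n R order_refl, where L = ?L])
    have "card (messages n R \<inter> ?L y) \<le> card (?L y)" for y
      by (intro card_mono) auto
    then show "real (card (messages n R \<inter> ?L y)) \<le> 2 powr (real n * 0)" for y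
      using n by simp
  qed (auto simp: correct_def comp_def)
  then show ?thesis using 1 2 by simp
qed

section \<open>Passage to the limit\<close>

theorem corollary2:
  fixes ch :: "'x::finite \<Rightarrow> ('y1::finite \<times> 'y2::finite) pmf"
    and C12 C21 R :: real
  assumes "C12 \<ge> 0" and "C21 \<ge> 0"
    and "achievable ch C12 C21 R"
  shows "R \<le> (SUP p::'x pmf.
      min (mutual_info_bits (joint_pmf ch p) (\<lambda>(x, y1, y2). x) (\<lambda>(x, y1, y2). y1) + C21)
        (min (mutual_info_bits (joint_pmf ch p) (\<lambda>(x, y1, y2). x) (\<lambda>(x, y1, y2). y2) + C12)
          (mutual_info_bits (joint_pmf ch p) (\<lambda>(x, y1, y2). x) (\<lambda>(x, y1, y2). (y1, y2)))))"
proof -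
  define F where "F = (\<lambda>p. min (channel_info p (\<lambda>x. map_pmf fst (ch x)) + C21)
      (min (channel_info p (\<lambda>x. map_pmf snd (ch x)) + C12) (channel_info p ch)))"
  have F: "min (mutual_info_bits (joint_pmf ch p) (\<lambda>(x, y1, y2). x) (\<lambda>(x, y1, y2). y1) + C21)
        (min (mutual_info_bits (joint_pmf ch p) (\<lambda>(x, y1, y2). x) (\<lambda>(x, y1, y2). y2) + C12)
          (mutual_info_bits (joint_pmf ch p) (\<lambda>(x, y1, y2). x) (\<lambda>(x, y1, y2). (y1, y2)))) = F p" for p
    using mutual_info_joint_pmf[of ch p fst] mutual_info_joint_pmf[of ch p snd]
      mutual_info_joint_pmf[of ch p "\<lambda>y. y"]
    by (simp add: F_def)
  \<comment> \<open>Boundedness makes the real-valued \<open>SUP\<close> an upper bound of its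
    terms; it suffices to bound the last argument of the minimum.\<close>
  have "bdd_above (range F)"
  proof (rule bdd_aboveI2)
    show "F p \<le> real (CARD('x)) / ln 2" for p
      using channel_info_le[of p ch] by (simp add: F_def)
  qed
  then have F_le: "F p \<le> (SUP p. F p)" for p by (rule cSUP_upper2) auto
  have "R - \<delta> \<le> (SUP p. F p)" if \<delta>: "\<delta> > 0" for \<delta>
  proof -
    define R' where "R' = max (R - \<delta>) 0"
    obtain c where c: "\<And>n. is_bc_code C12 C21 n R' (c n)"
      and err: "(\<lambda>n. error_prob ch n R' (c n)) \<longlonglongrightarrow> 0"
      using assms(3) \<delta> unfolding achievable_def R'_def by blast
    have "(\<lambda>n. R' * (1 - error_prob ch n R' (c n)) - 2 / real n) \<longlonglongrightarrow> R' * (1 - 0) - 0"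
      by (intro tendsto_intros err lim_const_over_n)
    \<comment> \<open>The input law varies with \<open>n\<close>, but the supremum does not, so no
      limit of input laws has to be taken.\<close>
    moreover have "R' * (1 - error_prob ch n R' (c n)) - 2 / real n \<le> (SUP p. F p)" if "n \<ge> 1" for n
    proof -
      have "R' * (1 - error_prob ch n R' (c n)) - 2 / real n \<le>
          F (average_input n (messages n R') (encoder (c n)))"
        unfolding F_def by (rule min_rate_bound[OF c]) (use that assms(1,2) in \<open>auto simp: R'_def\<close>)
      then show ?thesis using F_le by (rule order_trans)
    qed
    ultimately have "R' * (1 - 0) - 0 \<le> (SUP p. F p)"
      by (intro LIMSEQ_le_const2) auto
    then show ?thesis by (simp add: R'_def)
  qed
  then have "R \<le> (SUP p. F p) + \<delta>" if "\<delta> > 0" for \<delta> using that by force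
  then have "R \<le> (SUP p. F p)" by (rule field_le_epsilon)
  then show ?thesis unfolding F .
qed

end
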